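(* Fix an integer $d \geq 2$. For every integer $n > d+1$, we have $A_d(n)\ge 2$ and $$A_d(n) \leq \begin{cases} n-2, & d = 2,3,\\ 2\left\lceil \frac{n}{2} \right\rceil - 3, & d = 4,5,\\ 2\left\lceil \frac{n}{\lfloor d/2 \rfloor} \right\rceil - 2, & d \geq 6.\end{cases}$$ For every integer $n$ with $3 \leq n \leq d+1$, we have $A_d(n) = 1$.
   Context: $A_d(n)$ is the minimum, over all sets $\mathcal P\subset\mathbb{R}^d$ of $n$ points that are not all collinear, of the number of distinct values in the open interval $(0,\pi)$ of angles $\angle pqr$ with $p,q,r$ distinct points of $\mathcal P$ (angles of $0$ and $\pi$ are not counted). *)

theory Defs
  imports "HOL-Analysis.Analysis"
begin

text \<open>The angle at the middle point \<open>q\<close>; meaningful only for \<open>p \<noteq> q\<close> and \<open>r \<noteq> q\<close>.\<close>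
definition angle :: "'a::real_inner \<Rightarrow> 'a \<Rightarrow> 'a \<Rightarrow> real" where
  "angle p q r = arccos (((p - q) \<bullet> (r - q)) / (norm (p - q) * norm (r - q)))"

definition angles :: "'a::real_inner set \<Rightarrow> real set" where
  "angles P = {angle p q r | p q r.
     p \<in> P \<and> q \<in> P \<and> r \<in> P \<and> p \<noteq> q \<and> q \<noteq> r \<and> p \<noteq> r} \<inter> {0<..<pi}"

text \<open>The dimension \<open>d\<close> is \<open>CARD('d)\<close>. As \<open>Inf\<close> is taken over a set of natural numbers, it is a
  minimum whenever there is an admissible point set at all, that is, if \<open>n \<ge> 3\<close> and \<open>d \<ge> 2\<close>.\<close>
definition min_angles :: "'d::finite itself \<Rightarrow> nat \<Rightarrow> nat" where
  "min_angles TYPE('d) n =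
     Inf {card (angles P) | P :: (real ^ 'd) set. finite P \<and> card P = n \<and> \<not> collinear P}"

end

theory Submission
  imports Defs
begin

text \<open>If only one angle in \<open>(0, pi)\<close> occurs, then every non-degenerate triangle of the set is
  equilateral, so all distances agree and the set is affinely independent, hence has at most
  \<open>d + 1\<close> points. A regular simplex shows that this is sharp.

  For the upper bounds, put a regular \<open>m\<close>-gon on each of \<open>k = d div 2\<close> unit circles around the
  origin in pairwise orthogonal planes (Lenz's configuration) and keep \<open>n\<close> of the \<open>k * m\<close> vertices.
  The inscribed angles of one polygon are the \<open>m - 2\<close> multiples of \<open>pi / m\<close>. Points of different
  circles have distance \<open>sqrt 2\<close>, so triangles meeting two circles are isosceles with a chord as
  base and give \<open>m - 1\<close> further angles at most, and triangles meeting three circles are equilateral.\<close>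


section \<open>Cosines of angles in terms of distances\<close>

text \<open>\<open>arccos\<close> is injective on [-1, 1], so comparing and counting angles reduces
  to algebra with these quotients.\<close>

definition cosine :: "'a::real_inner \<Rightarrow> 'a \<Rightarrow> 'a \<Rightarrow> real" where
  "cosine p q r = ((p - q) \<bullet> (r - q)) / (norm (p - q) * norm (r - q))"

lemma cosine_commute: "cosine p q r = cosine r q p"
  by (simp add: cosine_def inner_commute mult.commute)

lemma inner_diff_conv_dist:
  fixes p q r :: "'a::real_inner"
  shows "(p - q) \<bullet> (r - q) = ((dist p q)\<^sup>2 + (dist q r)\<^sup>2 - (dist p r)\<^sup>2) / 2"
  by (simp add: dist_norm power2_norm_eq_inner inner_diff inner_commute)

lemma cosine_conv_dist:
  "cosine p q r = ((dist p q)\<^sup>2 + (dist q r)\<^sup>2 - (dist p r)\<^sup>2) / (2 * dist p q * dist q r)"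
  unfolding cosine_def inner_diff_conv_dist by (simp add: dist_norm norm_minus_commute)

lemma abs_cosine_le_1: "\<bar>cosine p q r\<bar> \<le> 1"
  unfolding cosine_def abs_divide abs_mult abs_norm_cancel
  by (intro divide_le_eq_1[THEN iffD2]) (use Cauchy_Schwarz_ineq2 in auto)

text \<open>Equality in Cauchy-Schwarz would make the two difference vectors parallel.\<close>

lemma abs_cosine_less_1:
  assumes "\<not> collinear {p, q, r}"
  shows "\<bar>cosine p q r\<bar> < 1"
proof -
  have "\<not> collinear {0, p - q, r - q}"
    using assms collinear_3[of p q r] by (simp add: NO_MATCH_def)
  then have "\<bar>(p - q) \<bullet> (r - q)\<bar> \<noteq> norm (p - q) * norm (r - q)"
    using norm_cauchy_schwarz_equal by blast
  moreover have "p \<noteq> q" "r \<noteq> q" using assms by (auto simp: insert_commute)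
  ultimately have "\<bar>cosine p q r\<bar> \<noteq> 1"
    by (simp add: cosine_def)
  with abs_cosine_le_1[of p q r] show ?thesis by simp
qed

lemma angle_conv_cosine: "angle p q r = arccos (cosine p q r)"
  by (simp add: angle_def cosine_def)

lemma finite_angles: "finite P \<Longrightarrow> finite (angles P)"
proof -
  assume "finite P"
  then have "finite ((\<lambda>(p, q, r). angle p q r) ` (P \<times> P \<times> P))" by simp
  then show ?thesis by (rule rev_finite_subset) (force simp: angles_def image_iff)
qed

lemma angle_in_angles:
  assumes "p \<in> P" "q \<in> P" "r \<in> P" "\<not> collinear {p, q, r}"
  shows "angle p q r \<in> angles P"
proof -
  have "p \<noteq> q" "q \<noteq> r" "p \<noteq> r" using assms(4) by (auto simp: insert_commute)
  moreover have "angle p q r \<in> {0<..<pi}"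
    using arccos_lt_bounded[of "cosine p q r"] abs_cosine_less_1[OF assms(4)]
    unfolding angle_conv_cosine greaterThanLessThan_iff by linarith
  ultimately show ?thesis using assms(1-3) unfolding angles_def by blast
qed

section \<open>Sets with a single angle are equidistant, hence small\<close>

lemma noncollinear_third_point:
  assumes "\<not> collinear P" "p \<in> P" "q \<in> P" "p \<noteq> q"
  obtains x where "x \<in> P" "\<not> collinear {p, q, x}"
proof -
  have "P = insert p (insert q P)" using assms by auto
  then show ?thesis using collinear_triples[of p q P] assms that by auto
qed

lemma noncollinear_two_points:
  assumes "\<not> collinear P"
  obtains p q where "p \<in> P" "q \<in> P" "p \<noteq> q"
proof -
  obtain p where "p \<in> P" using assms collinear_empty by (cases "P = {}") auto
  moreover have "P \<noteq> {p}" using assms collinear_sing by metis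
  ultimately show ?thesis using that by blast
qed

lemma angles_nonempty:
  assumes "\<not> collinear P"
  shows "angles P \<noteq> {}"
proof -
  obtain p q where "p \<in> P" "q \<in> P" "p \<noteq> q"
    using noncollinear_two_points[OF assms] .
  then obtain x where "x \<in> P" "\<not> collinear {p, q, x}"
    using noncollinear_third_point[OF assms] by blast
  with \<open>p \<in> P\<close> \<open>q \<in> P\<close> have "angle p q x \<in> angles P" by (intro angle_in_angles)
  then show ?thesis by blast
qed

text \<open>By the law of cosines the difference of the two cosines is a multiple of
  \<open>(b - a) * ((a + b)\<^sup>2 - c\<^sup>2)\<close> for the side lengths \<open>a\<close>, \<open>b\<close>, \<open>c\<close>; no angle sum is needed.\<close>
lemma isosceles_if_angles_eq:
  assumes nc: "\<not> collinear {p, q, r}" and eq: "angle q p r = angle p q r"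
  shows "dist p r = dist q r"
proof -
  have neq: "p \<noteq> q" "q \<noteq> r" "p \<noteq> r" using nc by (auto simp: insert_commute)
  define a b c where "a = dist q r" and "b = dist p r" and "c = dist p q"
  have pos: "a > 0" "b > 0" "c > 0" using neq by (auto simp: a_def b_def c_def)
  have cos_eq: "cosine q p r = cosine p q r"
    using eq abs_cosine_le_1[of q p r] abs_cosine_le_1[of p q r]
    by (simp add: angle_conv_cosine arccos_eq_iff)
  have "(c\<^sup>2 + b\<^sup>2 - a\<^sup>2) / (2 * c * b) = (c\<^sup>2 + a\<^sup>2 - b\<^sup>2) / (2 * c * a)"
    using cos_eq by (simp add: cosine_conv_dist a_def b_def c_def dist_commute)
  then have "(2 * c) * ((c\<^sup>2 + b\<^sup>2 - a\<^sup>2) * a) = (2 * c) * ((c\<^sup>2 + a\<^sup>2 - b\<^sup>2) * b)"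
    using pos by (simp add: frac_eq_eq mult_ac)
  then have "(c\<^sup>2 + b\<^sup>2 - a\<^sup>2) * a = (c\<^sup>2 + a\<^sup>2 - b\<^sup>2) * b"
    using pos by simp
  then have "(a - b) * (c + a + b) * (a + b - c) = 0"
    by (simp add: algebra_simps power2_eq_square)
  \<comment> \<open>\<open>a + b = c\<close> would force the cosine at \<open>r\<close> to be -1,
    which non-collinearity excludes.\<close>
  moreover have "a + b \<noteq> c"
  proof
    assume c: "a + b = c"
    have "cosine p r q = (b\<^sup>2 + a\<^sup>2 - c\<^sup>2) / (2 * b * a)"
      by (simp add: cosine_conv_dist a_def b_def c_def dist_commute)
    also have "\<dots> = -1"
      using pos by (simp add: c[symmetric] field_simps power2_eq_square)
    finally have "cosine p r q = -1" .
    with abs_cosine_less_1[of p r q] nc show False by (simp add: insert_commute)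
  qed
  moreover have "c + a + b \<noteq> 0" using pos by linarith
  ultimately have "a = b" by simp
  then show ?thesis by (simp add: a_def b_def)
qed

text \<open>Two segments with a common endpoint have equal length (\<open>star\<close>); disjoint
  ones are compared through a segment that joins them.\<close>

lemma equidistant_if_card_angles_le_1:
  assumes "finite P" "\<not> collinear P" "card (angles P) \<le> 1"
  obtains s where "s > 0" "\<And>x y. x \<in> P \<Longrightarrow> y \<in> P \<Longrightarrow> x \<noteq> y \<Longrightarrow> dist x y = s"
proof -
  have same: "\<alpha> = \<beta>" if "\<alpha> \<in> angles P" "\<beta> \<in> angles P" for \<alpha> \<beta>
    using card_le_Suc0_iff_eq[OF finite_angles[OF assms(1)]] assms(3) that by simp
  have tri: "dist p r = dist q r" if "p \<in> P" "q \<in> P" "r \<in> P" "\<not> collinear {p, q, r}" for p q r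
  proof (rule isosceles_if_angles_eq[OF that(4)], rule same)
    show "angle q p r \<in> angles P" "angle p q r \<in> angles P"
      using that by (simp_all add: angle_in_angles insert_commute)
  qed
  have star: "dist p q = dist p r" if "p \<in> P" "q \<in> P" "r \<in> P" "p \<noteq> q" "p \<noteq> r" for p q r
  proof -
    obtain x where x: "x \<in> P" "\<not> collinear {p, q, x}"
      using noncollinear_third_point assms(2) \<open>p \<in> P\<close> \<open>q \<in> P\<close> \<open>p \<noteq> q\<close> by blast
    show ?thesis
    proof (cases "collinear {p, q, r}")
      \<comment> \<open>The point \<open>x\<close> off the line forms non-degenerate triangles with
        both segments, and these triangles share the side from \<open>p\<close> to
        \<open>x\<close>.\<close>
      case True
      have "\<not> collinear {p, r, x}"
      proof
        assume "collinear {p, r, x}"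
        moreover have "collinear {q, p, r}" using True by (simp add: insert_commute)
        ultimately have "collinear {q, p, x}"
          using collinear_3_trans[of q p r x] \<open>p \<noteq> r\<close> by blast
        with x show False by (simp add: insert_commute)
      qed
      then have "\<not> collinear {r, x, p}" "\<not> collinear {q, x, p}"
        using x(2) by (simp_all add: insert_commute)
      then have "dist r p = dist x p" "dist q p = dist x p"
        using tri that x(1) by blast+
      then show ?thesis by (simp add: dist_commute)
    next
      case False
      then have "\<not> collinear {q, r, p}" by (simp add: insert_commute)
      then have "dist q p = dist r p" using tri that by blast
      then show ?thesis by (simp add: dist_commute)
    qed
  qed
  obtain p q where pq: "p \<in> P" "q \<in> P" "p \<noteq> q"
    using noncollinear_two_points[OF assms(2)] .
  have eqd: "dist x y = dist p q" if "x \<in> P" "y \<in> P" "x \<noteq> y" for x y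
  proof (cases "x = p")
    case True
    then show ?thesis using star[of p y q] that pq by blast
  next
    case False
    then have "dist p x = dist p q" "dist x y = dist x p"
      using star[of p x q] star[of x y p] that pq by blast+
    then show ?thesis by (simp add: dist_commute)
  qed
  have "dist p q > 0" using \<open>p \<noteq> q\<close> by simp
  then show ?thesis using eqd by (rule that)
qed

text \<open>For an affine dependency \<open>U\<close>, the sum \<open>\<Sum>v. U v * (dist v w)\<^sup>2\<close> does not depend on \<open>w\<close>,
  while equidistance makes it equal to \<open>- s\<^sup>2 * U w\<close>; hence \<open>U\<close> is constant, and it sums to \<open>0\<close>.\<close>
lemma equidistant_affine_independent:
  fixes P :: "'a::euclidean_space set"
  assumes fin: "finite P" and "s > 0"
    and eqd: "\<And>x y. x \<in> P \<Longrightarrow> y \<in> P \<Longrightarrow> x \<noteq> y \<Longrightarrow> dist x y = s"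
  shows "\<not> affine_dependent P"
proof
  assume "affine_dependent P"
  then obtain U w0 where U: "sum U P = 0" "(\<Sum>v\<in>P. U v *\<^sub>R v) = 0" and w0: "w0 \<in> P" "U w0 \<noteq> 0"
    unfolding affine_dependent_explicit_finite[OF fin] by blast
  define K where "K = (\<Sum>v\<in>P. U v * (v \<bullet> v))"
  have const: "U w = - K / s\<^sup>2" if w: "w \<in> P" for w
  proof -
    have "(\<Sum>v\<in>P. U v * (dist v w)\<^sup>2)
        = (\<Sum>v\<in>P. U v * (v \<bullet> v) - 2 * ((U v *\<^sub>R v) \<bullet> w) + U v * (w \<bullet> w))"
      by (intro sum.cong refl)
        (simp add: dist_norm power2_norm_eq_inner inner_diff inner_commute algebra_simps)
    also have "\<dots> = K - 2 * ((\<Sum>v\<in>P. U v *\<^sub>R v) \<bullet> w) + sum U P * (w \<bullet> w)"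
      by (simp add: sum.distrib sum_subtractf K_def inner_sum_left sum_distrib_left sum_distrib_right)
    finally have 1: "(\<Sum>v\<in>P. U v * (dist v w)\<^sup>2) = K" using U by simp
    have "(\<Sum>v\<in>P. U v * (dist v w)\<^sup>2) = (\<Sum>v\<in>P - {w}. U v * s\<^sup>2)"
      using fin w eqd by (intro sum.mono_neutral_cong_right) auto
    also have "\<dots> = - U w * s\<^sup>2"
      using U fin w by (simp add: sum_distrib_right[symmetric] sum_diff1)
    finally show ?thesis using 1 \<open>s > 0\<close> by (simp add: field_simps)
  qed
  have "real (card P) * (- K / s\<^sup>2) = 0"
    using U(1) const by simp
  moreover have "card P \<noteq> 0" using fin w0(1) by auto
  ultimately have "- K / s\<^sup>2 = 0" by simp
  with const[OF w0(1)] w0(2) show False by simp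
qed

lemma card_angles_ge_2:
  fixes P :: "'a::euclidean_space set"
  assumes "finite P" "\<not> collinear P" "card P > DIM('a) + 1"
  shows "card (angles P) \<ge> 2"
proof (rule ccontr)
  assume "\<not> ?thesis"
  then have "card (angles P) \<le> 1" by simp
  then obtain s where "s > 0" "\<And>x y. x \<in> P \<Longrightarrow> y \<in> P \<Longrightarrow> x \<noteq> y \<Longrightarrow> dist x y = s"
    using equidistant_if_card_angles_le_1[OF assms(1,2)] by blast
  then have "\<not> affine_dependent P"
    by (rule equidistant_affine_independent[OF assms(1)])
  then show False
    using affine_dependent_biggerset[of P] assms by auto
qed

section \<open>From cosines to angle counts; the regular simplex\<close>

text \<open>For finite \<open>C\<close> this bounds the number of angles by \<open>card C\<close>,
  so upper bounds only require a list of the possible cosines.\<close>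

lemma angles_subset_arccos:
  assumes "\<And>p q r. p \<in> P \<Longrightarrow> q \<in> P \<Longrightarrow> r \<in> P \<Longrightarrow> p \<noteq> q \<Longrightarrow> q \<noteq> r \<Longrightarrow> p \<noteq> r \<Longrightarrow>
    cosine p q r \<in> C"
  shows "angles P \<subseteq> arccos ` C"
proof
  fix x assume "x \<in> angles P"
  then obtain p q r where "p \<in> P" "q \<in> P" "r \<in> P" "p \<noteq> q" "q \<noteq> r" "p \<noteq> r" "x = arccos (cosine p q r)"
    unfolding angles_def angle_conv_cosine by blast
  with assms show "x \<in> arccos ` C" by blast
qed

lemma cosine_equidistant:
  assumes "s > 0" "\<And>x y. x \<in> P \<Longrightarrow> y \<in> P \<Longrightarrow> x \<noteq> y \<Longrightarrow> dist x y = s"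
    and "p \<in> P" "q \<in> P" "r \<in> P" "p \<noteq> q" "q \<noteq> r" "p \<noteq> r"
  shows "cosine p q r = 1 / 2"
proof -
  have "dist p q = s" "dist q r = s" "dist p r = s" using assms(2-) by simp_all
  with \<open>s > 0\<close> show ?thesis by (simp add: cosine_conv_dist power2_eq_square)
qed

lemma regular_simplex_exists:
  obtains S :: "(real ^ 'd::finite) set"
  where "finite S" "card S = CARD('d) + 1"
    "\<And>x y. x \<in> S \<Longrightarrow> y \<in> S \<Longrightarrow> x \<noteq> y \<Longrightarrow> dist x y = sqrt 2"
proof -
  define d where "d = real CARD('d)"
  have d: "d > 0" by (simp add: d_def)
  \<comment> \<open>The unit vectors have mutual distance \<open>sqrt 2\<close>. The last vertex is
    sought on the diagonal as \<open>(t, ..., t)\<close>; the same distance to each unit vector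
    requires \<open>d * t * t - 2 * t + 1 = 2\<close>, and \<open>t\<close> is the positive
    root.\<close>
  define t where "t = (1 + sqrt (1 + d)) / d"
  define e :: "'d \<Rightarrow> real ^ 'd" where "e = (\<lambda>i. axis i 1)"
  define z :: "real ^ 'd" where "z = (\<chi> i. t)"
  have "(d * t - 1)\<^sup>2 = 1 + d" using d by (simp add: t_def)
  then have "d * (d * t * t - 2 * t - 1) = 0"
    by (simp add: power2_eq_square algebra_simps)
  then have "d * t * t - 2 * t - 1 = 0" using d by simp
  moreover have "z \<bullet> z = d * t * t" by (simp add: z_def d_def inner_vec_def)
  moreover have "z \<bullet> e i = t" for i by (simp add: z_def e_def inner_axis)
  moreover have ee: "e i \<bullet> e j = (if i = j then 1 else 0)" for i j
    by (simp add: e_def inner_axis_axis)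
  ultimately have ze: "dist z (e i) = sqrt 2" for i
    by (simp add: dist_norm norm_eq_sqrt_inner inner_diff inner_commute algebra_simps)
  have ed: "dist (e i) (e j) = sqrt 2" if "i \<noteq> j" for i j
    using that ee by (simp add: dist_norm norm_eq_sqrt_inner inner_diff inner_commute)
  have "inj e"
  proof (rule injI, rule ccontr)
    fix i j assume "e i = e j" "i \<noteq> j"
    then show False using ed[of i j] by simp
  qed
  moreover have "z \<notin> range e"
  proof
    assume "z \<in> range e"
    then obtain i where "z = e i" by blast
    then show False using ze[of i] by simp
  qed
  ultimately have "card (insert z (range e)) = CARD('d) + 1"
    by (simp add: card_image)
  moreover have "dist x y = sqrt 2"
    if "x \<in> insert z (range e)" "y \<in> insert z (range e)" "x \<noteq> y" for x y
    using that ze ed by (auto simp: dist_commute) (metis ed)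
  ultimately show ?thesis by (intro that[of "insert z (range e)"]) auto
qed

section \<open>Regular polygons in orthogonal planes\<close>

text \<open>A line meets a sphere in at most two points: for \<open>b\<close> on the line through
  \<open>a\<close> and \<open>c\<close>, comparing norms leaves
  \<open>u * (1 - u) * (a \<bullet> c - 1) = 0\<close>, and each factor makes two of the points
  equal.\<close>

lemma sphere_not_collinear:
  fixes P :: "'a::euclidean_space set"
  assumes "P \<subseteq> sphere 0 1" "card P \<ge> 3"
  shows "\<not> collinear P"
proof
  assume "collinear P"
  obtain T where T: "T \<subseteq> P" "card T = 3"
    using obtain_subset_with_card_n[OF assms(2)] by metis
  then obtain a b c where abc: "T = {a, b, c}" "a \<noteq> b" "b \<noteq> c" "a \<noteq> c"
    by (auto simp: card_3_iff)
  with T \<open>collinear P\<close> have "collinear {a, b, c}" by (metis collinear_subset)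
  then obtain u where u: "b = u *\<^sub>R a + (1 - u) *\<^sub>R c"
    using abc by (auto simp: collinear_3_expand)
  have norms: "a \<bullet> a = 1" "b \<bullet> b = 1" "c \<bullet> c = 1"
    using T assms(1) abc by (auto simp: dot_square_norm)
  have "b \<bullet> b = u * u * (a \<bullet> a) + 2 * u * (1 - u) * (a \<bullet> c) + (1 - u) * (1 - u) * (c \<bullet> c)"
    unfolding u by (simp add: inner_add inner_commute algebra_simps)
  then have "2 * (u * ((1 - u) * (a \<bullet> c - 1))) = 0"
    unfolding norms by (simp add: algebra_simps)
  then have "u = 0 \<or> u = 1 \<or> a \<bullet> c = 1" by auto
  moreover have "a = c" if "a \<bullet> c = 1"
  proof -
    have "(a - c) \<bullet> (a - c) = 0" using that norms by (simp add: inner_diff inner_commute)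
    then show ?thesis by simp
  qed
  ultimately show False using u abc by auto
qed

text \<open>The vertex with index \<open>(i, a)\<close> is the \<open>a\<close>-th vertex of a regular \<open>m\<close>-gon inscribed in the
  \<open>i\<close>-th of \<open>k\<close> unit circles around the origin that lie in pairwise orthogonal planes.\<close>
locale orthogonal_polygons =
  fixes c :: "nat \<times> nat \<Rightarrow> 'a::real_inner" and k m :: nat
  assumes m_ge_3: "m \<ge> 3"
    and inner_c: "\<And>i j a b. i < k \<Longrightarrow> j < k \<Longrightarrow> a < m \<Longrightarrow> b < m \<Longrightarrow>
      c (i, a) \<bullet> c (j, b) = (if i = j then cos (2 * (pi * (real a - real b) / real m)) else 0)"
begin

definition vertices :: "'a set" where
  "vertices = c ` ({..<k} \<times> {..<m})"

text \<open>An inscribed angle is \<open>pi / m\<close> times the number \<open>l\<close> of polygon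
  sides on the arc it subtends. The apex lies on the other arc, which therefore has at least two
  sides, so \<open>l\<close> is at most \<open>m - 2\<close>.\<close>

definition inscribed_cosines :: "real set" where
  "inscribed_cosines = (\<lambda>l. cos (pi * real l / real m)) ` {1..m - 2}"

text \<open>Apex and base angles of isosceles triangles with legs \<open>sqrt 2\<close> and a chord
  of length \<open>2 * sin (pi * l / m)\<close> as base. Both ranges are halved by the symmetry
  between \<open>l\<close> and \<open>m - l\<close>; the first also omits
  \<open>2 * l = m\<close>.\<close>

definition mixed_cosines :: "real set" where
  "mixed_cosines = (\<lambda>l. (cos (pi * real l / real m))\<^sup>2) ` {1..(m - 1) div 2} \<union>
     (\<lambda>l. sin (pi * real l / real m) / sqrt 2) ` {1..m div 2}"

lemma sin_pos:
  assumes "0 < t" "t < real m"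
  shows "sin (pi * t / real m) > 0"
  using assms m_ge_3 by (intro sin_gt_zero) (auto simp: field_simps)

text \<open>The argument lies in \<open>(-pi, pi)\<close>, where sine has the sign of its argument.
  Applied to index differences, this turns signs of sines into the order of the indices.\<close>

lemma sgn_sin:
  assumes "\<bar>t\<bar> < real m"
  shows "sgn (sin (pi * t / real m)) = sgn t"
proof -
  consider "t > 0" | "t = 0" | "t < 0" by linarith
  then show ?thesis
  proof cases
    case 3
    then show ?thesis using sin_pos[of "- t"] assms by simp
  qed (use sin_pos[of t] assms in auto)
qed

lemma half_angle_reflect:
  assumes "l \<le> m"
  shows "cos (pi * real (m - l) / real m) = - cos (pi * real l / real m)"
    and "sin (pi * real (m - l) / real m) = sin (pi * real l / real m)"
proof -
  have "pi * real (m - l) / real m = pi - pi * real l / real m"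
    using assms m_ge_3 by (simp add: of_nat_diff diff_divide_distrib right_diff_distrib)
  then show "cos (pi * real (m - l) / real m) = - cos (pi * real l / real m)"
    and "sin (pi * real (m - l) / real m) = sin (pi * real l / real m)"
    by simp_all
qed

lemma norm_c: "i < k \<Longrightarrow> a < m \<Longrightarrow> norm (c (i, a)) = 1"
  by (simp add: norm_eq_sqrt_inner inner_c)

lemma norm_diff_same:
  assumes "i < k" "a < m" "b < m"
  shows "norm (c (i, a) - c (i, b)) = 2 * \<bar>sin (pi * (real a - real b) / real m)\<bar>"
proof -
  define x where "x = pi * (real a - real b) / real m"
  have "pi * (real b - real a) / real m = - x"
    by (simp add: x_def diff_divide_distrib right_diff_distrib)
  then have "(norm (c (i, a) - c (i, b)))\<^sup>2 = 2 - 2 * cos (2 * x)"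
    using assms unfolding power2_norm_eq_inner
    by (simp add: inner_diff inner_c x_def[symmetric])
  also have "\<dots> = (2 * \<bar>sin x\<bar>)\<^sup>2"
    by (simp add: cos_double_sin power_mult_distrib)
  finally show ?thesis
    unfolding x_def[symmetric] by (rule power2_eq_imp_eq) auto
qed

lemma norm_diff_other:
  assumes "i < k" "j < k" "i \<noteq> j" "a < m" "b < m"
  shows "norm (c (i, a) - c (j, b)) = sqrt 2"
  using assms by (simp add: norm_eq_sqrt_inner inner_diff inner_c)

lemma inj_on_c: "inj_on c ({..<k} \<times> {..<m})"
proof (rule inj_onI, clarify)
  fix i a j b
  assume *: "i < k" "a < m" "j < k" "b < m" "c (i, a) = c (j, b)"
  then have "i = j" using norm_diff_other[of i j a b] by auto
  with * have "sgn (sin (pi * (real a - real b) / real m)) = 0"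
    using norm_diff_same[of i a b] by simp
  with * have "a = b" by (subst (asm) sgn_sin) (auto simp: sgn_0_0)
  with \<open>i = j\<close> show "i = j \<and> a = b" by simp
qed

lemma card_vertices: "card vertices = k * m"
  unfolding vertices_def by (simp add: card_image[OF inj_on_c])

lemma vertices_subset_sphere: "vertices \<subseteq> sphere 0 1"
  by (auto simp: vertices_def norm_c)

text \<open>The arc from \<open>a\<close> to \<open>d\<close> contains the apex \<open>b\<close>, so
  the angle subtends the complementary arc of \<open>m - (d - a)\<close> sides.\<close>

lemma inscribed_cosines_if_between:
  assumes "a < m" "d < m" "a < b \<and> b < d"
  shows "- cos (pi * (real a - real d) / real m) \<in> inscribed_cosines"
proof -
  have "pi * (real a - real d) / real m = - (pi * real (d - a) / real m)"
    using assms by (simp add: of_nat_diff diff_divide_distrib right_diff_distrib)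
  then have "- cos (pi * (real a - real d) / real m) = cos (pi * real (m - (d - a)) / real m)"
    using half_angle_reflect(1)[of "d - a"] assms by simp
  moreover have "m - (d - a) \<in> {1..m - 2}" using assms by auto
  ultimately show ?thesis unfolding inscribed_cosines_def by blast
qed

text \<open>Here the angle subtends the arc of \<open>d - a\<close> sides itself; an index outside
  the interval forces \<open>d - a \<le> m - 2\<close>.\<close>

lemma inscribed_cosines_if_not_between:
  assumes "a < m" "b < m" "d < m" "a < d" "b < a \<or> d < b"
  shows "cos (pi * (real a - real d) / real m) \<in> inscribed_cosines"
proof -
  have "pi * (real a - real d) / real m = - (pi * real (d - a) / real m)"
    using assms by (simp add: of_nat_diff diff_divide_distrib right_diff_distrib)
  then have "cos (pi * (real a - real d) / real m) = cos (pi * real (d - a) / real m)"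
    by simp
  moreover have "d - a \<in> {1..m - 2}" using assms by auto
  ultimately show ?thesis unfolding inscribed_cosines_def by blast
qed

text \<open>The inscribed angle theorem: the inner product factors as
  \<open>4 * sin x * sin y * cos (x - y)\<close>, the norms cancel the sines up to sign, and
  \<open>sgn_sin\<close> reads the signs off the indices.\<close>

lemma cosine_same:
  assumes i: "i < k" and abd: "a < m" "b < m" "d < m" "a \<noteq> b" "b \<noteq> d" "a \<noteq> d"
  shows "cosine (c (i, a)) (c (i, b)) (c (i, d)) \<in> inscribed_cosines"
proof -
  define x where "x = pi * (real a - real b) / real m"
  define y where "y = pi * (real d - real b) / real m"
  have xy: "pi * (real a - real d) / real m = x - y" "pi * (real b - real d) / real m = - y"
    by (simp_all add: x_def y_def diff_divide_distrib right_diff_distrib)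
  have "(c (i, a) - c (i, b)) \<bullet> (c (i, d) - c (i, b))
      = cos (2 * (x - y)) - cos (2 * x) - cos (2 * y) + 1"
    using i abd by (simp add: inner_diff inner_c xy x_def[symmetric])
  also have "\<dots> = 4 * sin x * sin y * cos (x - y)"
  proof -
    have "cos (2 * x) + cos (2 * y) = 2 * cos (x + y) * cos (x - y)"
      using cos_plus_cos[of "2 * x" "2 * y"] by (simp add: add_divide_distrib diff_divide_distrib)
    then have "cos (2 * (x - y)) - cos (2 * x) - cos (2 * y) + 1
        = 2 * cos (x - y) * (cos (x - y) - cos (x + y))"
      using cos_double_cos[of "x - y"] by (simp add: algebra_simps power2_eq_square)
    then show ?thesis by (simp add: cos_diff cos_add algebra_simps)
  qed
  finally have "cosine (c (i, a)) (c (i, b)) (c (i, d))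
      = 4 * sin x * sin y * cos (x - y) / (2 * \<bar>sin x\<bar> * (2 * \<bar>sin y\<bar>))"
    using i abd by (simp add: cosine_def norm_diff_same x_def y_def)
  also have "\<dots> = sgn (sin x) * sgn (sin y) * cos (x - y)"
    by (simp add: sgn_if)
  also have "\<dots> = sgn (real a - real b) * sgn (real d - real b) * cos (pi * (real a - real d) / real m)"
    using abd unfolding x_def y_def xy(1)[symmetric, unfolded x_def y_def] by (simp add: sgn_sin)
  finally have eq: "cosine (c (i, a)) (c (i, b)) (c (i, d)) = \<dots>" .
  have sym: "cos (pi * (real a - real d) / real m) = cos (pi * (real d - real a) / real m)"
    by (metis cos_minus minus_diff_eq minus_divide_left mult_minus_right)
  \<comment> \<open>The product of the signs is -1 if \<open>b\<close> lies between \<open>a\<close>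
    and \<open>d\<close>, in either order, and 1 otherwise.\<close>
  consider "a < b" "b < d" | "d < b" "b < a" | "a < d" "b < a \<or> d < b" | "d < a" "b < d \<or> a < b"
    using abd by linarith
  then show ?thesis
  proof cases
    case 1
    then show ?thesis using inscribed_cosines_if_between[of a d b] abd eq by simp
  next
    case 2
    then show ?thesis using inscribed_cosines_if_between[of d a b] abd eq sym by simp
  next
    case 3
    then have "sgn (real a - real b) * sgn (real d - real b) = 1" by auto
    then show ?thesis using inscribed_cosines_if_not_between[of a b d] abd eq 3 by simp
  next
    case 4
    then have "sgn (real a - real b) * sgn (real d - real b) = 1" by auto
    then show ?thesis using inscribed_cosines_if_not_between[of d b a] abd eq sym 4 by simp
  qed
qed

text \<open>Replacing \<open>l\<close> by \<open>m - l\<close> halves the range; the value \<open>0\<close>, which occurs for \<open>2 * l = m\<close>, is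
  the cosine of an inscribed angle, so a right angle is counted only once.\<close>
lemma cos_squared_mem:
  assumes "0 < l" "l < m"
  shows "(cos (pi * real l / real m))\<^sup>2 \<in> inscribed_cosines \<union> mixed_cosines"
proof -
  consider "2 * l < m" | "2 * l = m" | "2 * l > m" by linarith
  then show ?thesis
  proof cases
    case 1
    then have "l \<in> {1..(m - 1) div 2}" using assms by auto
    then show ?thesis unfolding mixed_cosines_def by blast
  next
    case 2
    then have half: "pi * real l / real m = pi / 2" using assms by (simp add: field_simps flip: 2)
    have "(cos (pi * real l / real m))\<^sup>2 = cos (pi * real l / real m)"
      unfolding half by simp
    moreover have "l \<in> {1..m - 2}" using 2 m_ge_3 by auto
    ultimately show ?thesis unfolding inscribed_cosines_def by auto
  next
    case 3
    then have "m - l \<in> {1..(m - 1) div 2}" using assms by auto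
    moreover have "(cos (pi * real l / real m))\<^sup>2 = (cos (pi * real (m - l) / real m))\<^sup>2"
      using half_angle_reflect(1)[of l] assms by simp
    ultimately show ?thesis unfolding mixed_cosines_def by blast
  qed
qed

lemma sin_mem:
  assumes "0 < l" "l < m"
  shows "sin (pi * real l / real m) / sqrt 2 \<in> mixed_cosines"
proof (cases "2 * l \<le> m")
  case True
  then have "l \<in> {1..m div 2}" using assms by auto
  then show ?thesis unfolding mixed_cosines_def by blast
next
  case False
  then have "m - l \<in> {1..m div 2}" using assms by auto
  moreover have "sin (pi * real l / real m) = sin (pi * real (m - l) / real m)"
    using half_angle_reflect(2)[of l] assms by simp
  ultimately show ?thesis unfolding mixed_cosines_def by auto
qed

text \<open>Replaces a signed index difference by a positive number of steps, as used in the sets of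
  cosines.\<close>

lemma index_diff:
  assumes "a < m" "d < m" "a \<noteq> d"
  obtains l where "0 < l" "l < m"
    "cos (pi * (real a - real d) / real m) = cos (pi * real l / real m)"
    "\<bar>sin (pi * (real a - real d) / real m)\<bar> = sin (pi * real l / real m)"
proof (cases "a < d")
  case True
  have "pi * (real a - real d) / real m = - (pi * real (d - a) / real m)"
    using True by (simp add: of_nat_diff diff_divide_distrib right_diff_distrib)
  moreover have "sin (pi * real (d - a) / real m) > 0"
    using assms True by (intro sin_pos) auto
  ultimately show ?thesis using that[of "d - a"] assms True by simp
next
  case False
  have "pi * (real a - real d) / real m = pi * real (a - d) / real m"
    using False by (simp add: of_nat_diff)
  moreover have "sin (pi * real (a - d) / real m) > 0"
    using assms False by (intro sin_pos) auto
  ultimately show ?thesis using that[of "a - d"] assms False by simp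
qed

text \<open>Both legs have length \<open>sqrt 2\<close>, so the double-angle formula gives a squared
  cosine. For antipodal ends of the base the angle is right, hence the union with
  \<open>inscribed_cosines\<close>.\<close>

lemma cosine_apex_other:
  assumes "i < k" "j < k" "i \<noteq> j" "a < m" "b < m" "d < m" "a \<noteq> d"
  shows "cosine (c (i, a)) (c (j, b)) (c (i, d)) \<in> inscribed_cosines \<union> mixed_cosines"
proof -
  obtain l where l: "0 < l" "l < m"
    "cos (pi * (real a - real d) / real m) = cos (pi * real l / real m)"
    using index_diff[of a d] assms by blast
  define x where "x = pi * (real a - real d) / real m"
  have "cosine (c (i, a)) (c (j, b)) (c (i, d)) = (cos (2 * x) + 1) / 2"
    using assms by (simp add: cosine_def norm_diff_other inner_diff inner_c x_def)
  also have "\<dots> = (cos (pi * (real a - real d) / real m))\<^sup>2"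
    by (simp add: cos_double_cos x_def[symmetric])
  finally have "cosine (c (i, a)) (c (j, b)) (c (i, d)) = \<dots>" .
  then show ?thesis using cos_squared_mem[OF l(1,2)] l(3) by simp
qed

text \<open>A base angle of an isosceles triangle: its cosine is half the chord divided by the leg
  \<open>sqrt 2\<close>.\<close>

lemma cosine_leg_other:
  assumes "i < k" "j < k" "i \<noteq> j" "a < m" "b < m" "d < m" "a \<noteq> b"
  shows "cosine (c (i, a)) (c (i, b)) (c (j, d)) \<in> mixed_cosines"
proof -
  define x where "x = pi * (real a - real b) / real m"
  obtain l where l: "0 < l" "l < m" "\<bar>sin x\<bar> = sin (pi * real l / real m)"
    using index_diff[of a b] assms unfolding x_def by blast
  have pos: "\<bar>sin x\<bar> > 0" unfolding l using l by (intro sin_pos) auto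
  have "norm (c (j, d) - c (i, b)) = sqrt 2" using assms by (intro norm_diff_other) auto
  then have "cosine (c (i, a)) (c (i, b)) (c (j, d)) = (1 - cos (2 * x)) / (2 * \<bar>sin x\<bar> * sqrt 2)"
    using assms by (simp add: cosine_def norm_diff_same inner_diff inner_c x_def)
  also have "\<dots> = 2 * \<bar>sin x\<bar>\<^sup>2 / (2 * \<bar>sin x\<bar> * sqrt 2)"
    by (simp add: cos_double_sin)
  also have "\<dots> = \<bar>sin x\<bar> / sqrt 2" using pos by (simp add: power2_eq_square field_simps)
  finally show ?thesis using sin_mem[OF l(1,2)] l(3) by simp
qed

lemma cosine_vertices:
  assumes "p \<in> vertices" "q \<in> vertices" "r \<in> vertices" "p \<noteq> q" "q \<noteq> r" "p \<noteq> r"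
  shows "cosine p q r \<in> inscribed_cosines \<union> (if k \<ge> 2 then mixed_cosines else {}) \<union>
    (if k \<ge> 3 then {1 / 2} else {})"
proof -
  obtain i a j b l d where ix: "p = c (i, a)" "q = c (j, b)" "r = c (l, d)"
    "i < k" "j < k" "l < k" "a < m" "b < m" "d < m"
    using assms(1-3) unfolding vertices_def by auto
  \<comment> \<open>The cases record which of the three points share a circle: all, the two ends,
    the apex with one end, or none.\<close>
  consider "i = j" "j = l" | "i = l" "i \<noteq> j" | "i = j" "j \<noteq> l" | "j = l" "i \<noteq> j"
    | "i \<noteq> j" "j \<noteq> l" "i \<noteq> l" by blast
  then show ?thesis
  proof cases
    case 1
    then have "cosine p q r \<in> inscribed_cosines" using cosine_same assms ix by blast
    then show ?thesis by blast
  next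
    case 2
    then have "cosine p q r \<in> inscribed_cosines \<union> mixed_cosines" "k \<ge> 2"
      using cosine_apex_other[of i j a b d] assms ix by auto
    then show ?thesis by auto
  next
    case 3
    then have "cosine p q r \<in> mixed_cosines" "k \<ge> 2"
      using cosine_leg_other[of i l a b d] assms ix by auto
    then show ?thesis by auto
  next
    case 4
    then have "cosine p q r \<in> mixed_cosines" "k \<ge> 2"
      using cosine_leg_other[of j i d b a] cosine_commute[of p q r] assms ix by auto
    then show ?thesis by auto
  next
    case 5
    then have "cosine p q r = 1 / 2"
      using ix by (simp add: cosine_def norm_diff_other inner_diff inner_c)
    moreover have "k \<ge> 3" using 5 ix by linarith
    ultimately show ?thesis by simp
  qed
qed

lemma finite_cosines: "finite inscribed_cosines" "finite mixed_cosines"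
  by (simp_all add: inscribed_cosines_def mixed_cosines_def)

lemma card_inscribed_cosines: "card inscribed_cosines \<le> m - 2"
  unfolding inscribed_cosines_def by (rule order_trans[OF card_image_le]) auto

lemma card_mixed_cosines: "card mixed_cosines \<le> m - 1"
proof -
  have "card mixed_cosines \<le> (m - 1) div 2 + m div 2"
    unfolding mixed_cosines_def
    by (intro order_trans[OF card_Un_le] add_mono order_trans[OF card_image_le]) auto
  also have "\<dots> = m - 1" using m_ge_3 by presburger
  finally show ?thesis .
qed

end

section \<open>Point sets with few angles\<close>

text \<open>Each circle receives two coordinate axes of its own through the enumeration
  \<open>h\<close>, which takes \<open>2 * k\<close> axes in all.\<close>

lemma orthogonal_polygons_exist:
  assumes "m \<ge> 3" "2 * k \<le> CARD('d::finite)"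
  obtains c :: "nat \<times> nat \<Rightarrow> real ^ 'd" where "orthogonal_polygons c k m"
proof -
  obtain h :: "nat \<Rightarrow> 'd" where "bij_betw h {0..<CARD('d)} UNIV"
    using ex_bij_betw_nat_finite[of "UNIV :: 'd set"] by auto
  then have h: "h x = h y \<longleftrightarrow> x = y" if "x < 2 * k" "y < 2 * k" for x y
    using that assms(2) by (auto simp: bij_betw_def dest!: inj_onD)
  define c where "c = (\<lambda>(i, a).
    cos (2 * (pi * real a / real m)) *\<^sub>R axis (h (2 * i)) (1 :: real) +
    sin (2 * (pi * real a / real m)) *\<^sub>R axis (h (2 * i + 1)) 1)"
  have "orthogonal_polygons c k m"
  proof
    fix i j a b assume *: "i < k" "j < k" "a < m" "b < m"
    \<comment> \<open>By parity, the cosine axis of one circle is never the sine axis of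
      another.\<close>
    have odd_even: "2 * i + 1 \<noteq> 2 * j" "2 * i \<noteq> 2 * j + 1" by presburger+
    have "2 * (pi * (real a - real b) / real m)
        = 2 * (pi * real a / real m) - 2 * (pi * real b / real m)"
      by (simp add: algebra_simps diff_divide_distrib)
    then show "c (i, a) \<bullet> c (j, b)
        = (if i = j then cos (2 * (pi * (real a - real b) / real m)) else 0)"
      using * odd_even by (simp add: c_def inner_add inner_axis_axis h cos_diff)
  qed (use assms in simp)
  with that show ?thesis .
qed

lemma orthogonal_polygons_few_angles:
  assumes "m \<ge> 3" "2 * k \<le> CARD('d::finite)" "3 \<le> n" "n \<le> k * m"
  obtains P :: "(real ^ 'd) set" where "finite P" "card P = n" "\<not> collinear P"
    "card (angles P) \<le> (m - 2) + (if k \<ge> 2 then m - 1 else 0) + (if k \<ge> 3 then 1 else 0)"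
proof -
  obtain c :: "nat \<times> nat \<Rightarrow> real ^ 'd" where "orthogonal_polygons c k m"
    using orthogonal_polygons_exist assms(1,2) by blast
  then interpret orthogonal_polygons c k m .
  obtain P where P: "P \<subseteq> vertices" "card P = n" "finite P"
    using obtain_subset_with_card_n[of n vertices] assms(4) card_vertices by auto
  have nc: "\<not> collinear P"
    using sphere_not_collinear[of P] P vertices_subset_sphere assms(3) by auto
  define C where "C = inscribed_cosines \<union> (if k \<ge> 2 then mixed_cosines else {}) \<union>
    (if k \<ge> 3 then {1 / 2} else {})"
  have "angles P \<subseteq> arccos ` C"
    unfolding C_def using P(1) by (intro angles_subset_arccos cosine_vertices) auto
  moreover have "finite C" by (simp add: C_def finite_cosines)
  ultimately have "card (angles P) \<le> card C" using surj_card_le by blast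
  also have "\<dots> \<le> card inscribed_cosines + card (if k \<ge> 2 then mixed_cosines else {}) +
      card (if k \<ge> 3 then {1 / 2 :: real} else {})"
    unfolding C_def by (intro order_trans[OF card_Un_le] add_mono card_Un_le order_refl)
  also have "\<dots> \<le> (m - 2) + (if k \<ge> 2 then m - 1 else 0) + (if k \<ge> 3 then 1 else 0)"
    using card_inscribed_cosines card_mixed_cosines by (intro add_mono) auto
  finally show ?thesis using that P nc by blast
qed

lemma regular_simplex_one_angle:
  assumes "3 \<le> n" "n \<le> CARD('d::finite) + 1"
  obtains P :: "(real ^ 'd) set" where "finite P" "card P = n" "\<not> collinear P"
    "card (angles P) \<le> 1"
proof -
  obtain S :: "(real ^ 'd) set" where S: "finite S" "card S = CARD('d) + 1"
    "\<And>x y. x \<in> S \<Longrightarrow> y \<in> S \<Longrightarrow> x \<noteq> y \<Longrightarrow> dist x y = sqrt 2"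
    using regular_simplex_exists by blast
  obtain P where P: "P \<subseteq> S" "card P = n" "finite P"
    using obtain_subset_with_card_n[of n S] assms(2) S(2) by metis
  have eqd: "dist x y = sqrt 2" if "x \<in> P" "y \<in> P" "x \<noteq> y" for x y
    using that S(3) P(1) by blast
  \<comment> \<open>Three equidistant points are affinely independent, so they cannot lie on a
    line.\<close>
  have "\<not> collinear P"
  proof
    assume coll: "collinear P"
    obtain T where T: "T \<subseteq> P" "card T = 3"
      using obtain_subset_with_card_n[of 3 P] P(2) assms(1) by metis
    then obtain p q r where pqr: "T = {p, q, r}" "p \<noteq> q" "q \<noteq> r" "p \<noteq> r"
      by (auto simp: card_3_iff)
    with T have "\<not> affine_dependent T"
      using eqd by (intro equidistant_affine_independent[of T "sqrt 2"]) auto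
    moreover have "collinear T" using coll T(1) by (rule collinear_subset)
    ultimately show False using pqr by (simp add: collinear_3_eq_affine_dependent)
  qed
  moreover have "angles P \<subseteq> arccos ` {1 / 2}"
    using cosine_equidistant[of "sqrt 2" P, OF _ eqd] by (intro angles_subset_arccos) simp
  then have "card (angles P) \<le> 1"
    using surj_card_le[of "{1 / 2 :: real}"] by simp
  ultimately show ?thesis using that P by blast
qed

section \<open>The minimum and its bounds\<close>

lemma min_angles_le:
  fixes P :: "(real ^ 'd::finite) set"
  assumes "finite P" "card P = n" "\<not> collinear P"
  shows "min_angles TYPE('d) n \<le> card (angles P)"
  unfolding min_angles_def by (rule cInf_lower) (use assms in auto)

text \<open>The given \<open>P\<close> makes the set under \<open>Inf\<close> nonempty, so
  \<open>Inf\<close> is a member of it and bounds valid for every admissible set pass to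
  \<open>min_angles\<close>.\<close>

lemma min_angles_attained:
  fixes P :: "(real ^ 'd::finite) set"
  assumes "finite P" "card P = n" "\<not> collinear P"
  obtains Q :: "(real ^ 'd) set" where "finite Q" "card Q = n" "\<not> collinear Q"
    "min_angles TYPE('d) n = card (angles Q)"
proof -
  let ?A = "{card (angles P) | P :: (real ^ 'd) set. finite P \<and> card P = n \<and> \<not> collinear P}"
  have "?A \<noteq> {}" using assms by blast
  from Inf_nat_def1[OF this] have "min_angles TYPE('d) n \<in> ?A"
    unfolding min_angles_def .
  then show ?thesis using that by blast
qed

theorem theorem7p3:
  fixes d :: nat
  assumes "d = CARD('d::finite)" and "d \<ge> 2"
  shows "(\<forall>n > d + 1.
            min_angles TYPE('d) n \<ge> 2 \<and>
            int (min_angles TYPE('d) n) \<le>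
              (if d = 2 \<or> d = 3 then int n - 2
               else if d = 4 \<or> d = 5 then 2 * \<lceil>real n / 2\<rceil> - 3
               else 2 * \<lceil>real n / real_of_int \<lfloor>real d / 2\<rfloor>\<rceil> - 2)) \<and>
         (\<forall>n. 3 \<le> n \<and> n \<le> d + 1 \<longrightarrow> min_angles TYPE('d) n = 1)"
proof (intro conjI allI impI)
  fix n assume n: "n > d + 1"
  define k where "k = d div 2"
  \<comment> \<open>The smallest polygon size for which \<open>k\<close> polygons have at least
    \<open>n\<close> vertices.\<close>
  define m where "m = (if k = 1 then n else nat \<lceil>real n / real k\<rceil>)"
  have k: "k \<ge> 1" "2 * k \<le> d" using assms(2) by (auto simp: k_def)
  have m: "m \<ge> 3 \<and> n \<le> k * m \<and> (k \<noteq> 1 \<longrightarrow> int m = \<lceil>real n / real k\<rceil>)"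
  proof (cases "k = 1")
    case True
    then show ?thesis using n assms(2) by (simp add: m_def)
  next
    case False
    \<comment> \<open>From \<open>n > d + 1\<close> and \<open>2 * k \<le> d\<close> the quotient
      exceeds 2, so its ceiling is at least 3 and the polygons are genuine.\<close>
    have "real (2 * k) < real n" using n k by linarith
    then have "real n / real k > 2" using k by (simp add: field_simps)
    then have "\<lceil>real n / real k\<rceil> \<ge> 3" by linarith
    moreover from this have "int m = \<lceil>real n / real k\<rceil>" using False by (simp add: m_def)
    ultimately have m: "m \<ge> 3" "int m = \<lceil>real n / real k\<rceil>" by linarith+
    then have "real n / real k \<le> real m" by linarith
    then have "real n \<le> real (k * m)" using k by (simp add: field_simps)
    with m show ?thesis by linarith
  qed
  obtain P :: "(real ^ 'd) set" where P: "finite P" "card P = n" "\<not> collinear P"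
    "card (angles P) \<le> (m - 2) + (if k \<ge> 2 then m - 1 else 0) + (if k \<ge> 3 then 1 else 0)"
    using orthogonal_polygons_few_angles[where 'd = 'd, of m k n] k m n assms by auto
  obtain Q :: "(real ^ 'd) set" where "finite Q" "card Q = n" "\<not> collinear Q"
    "min_angles TYPE('d) n = card (angles Q)"
    using min_angles_attained[OF P(1-3)] .
  then show "min_angles TYPE('d) n \<ge> 2"
    using card_angles_ge_2[of Q] n assms(1) by simp
  have le: "min_angles TYPE('d) n
      \<le> (m - 2) + (if k \<ge> 2 then m - 1 else 0) + (if k \<ge> 3 then 1 else 0)"
    using min_angles_le[OF P(1-3)] P(4) by linarith
  have floor_half: "\<lfloor>real d / 2\<rfloor> = int k"
    using floor_divide_of_nat_eq[of d 2] by (simp add: k_def)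
  \<comment> \<open>The bound in \<open>le\<close> becomes \<open>m - 2\<close>,
    \<open>2 * m - 3\<close> and \<open>2 * m - 2\<close> respectively.\<close>
  consider "d = 2 \<or> d = 3" "k = 1" | "d = 4 \<or> d = 5" "k = 2" | "d \<ge> 6" "k \<ge> 3"
    unfolding k_def using assms(2) by linarith
  then show "int (min_angles TYPE('d) n) \<le>
              (if d = 2 \<or> d = 3 then int n - 2
               else if d = 4 \<or> d = 5 then 2 * \<lceil>real n / 2\<rceil> - 3
               else 2 * \<lceil>real n / real_of_int \<lfloor>real d / 2\<rfloor>\<rceil> - 2)"
  proof cases
    case 1
    then show ?thesis using le m by (auto simp: m_def)
  next
    case 2
    have "int m = \<lceil>real n / 2\<rceil>" using m 2 by simp
    then show ?thesis using le m 2 by auto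
  next
    case 3
    have "int m = \<lceil>real n / real_of_int \<lfloor>real d / 2\<rfloor>\<rceil>" using m 3 floor_half by simp
    then show ?thesis using le m 3 by auto
  qed
next
  fix n assume n: "3 \<le> n \<and> n \<le> d + 1"
  then obtain P :: "(real ^ 'd) set" where P: "finite P" "card P = n" "\<not> collinear P"
    "card (angles P) \<le> 1"
    using regular_simplex_one_angle[where 'd = 'd, of n] assms(1) by blast
  obtain Q :: "(real ^ 'd) set" where Q: "finite Q" "\<not> collinear Q"
    "min_angles TYPE('d) n = card (angles Q)"
    using min_angles_attained[OF P(1-3)] by blast
  then have "min_angles TYPE('d) n \<noteq> 0"
    using angles_nonempty[of Q] finite_angles[of Q] by simp
  with min_angles_le[OF P(1-3)] P(4) show "min_angles TYPE('d) n = 1" by linarith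
qed

end
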